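(* Let $(X, \ll, \leq, d, \tau)$ be a globally hyperbolic Lorentzian length space. (1) If $(X, \ll, \leq, d, \tau)$ is finitely compact, then $(X, \ll, \leq, d, \tau)$ is timelike Cauchy complete. (2) If $(X, \ll, \leq, d, \tau)$ is timelike Cauchy complete, then $(X, \ll, \leq, d, \tau)$ satisfies Condition A.
   Context: **Causal space.** $(X,\ll,\leq)$ is a set $X$ with two transitive relations $\ll,\leq$ such that $\leq$ is reflexive and $x\ll y$ implies $x\leq y$. Write $x<y$ if $x\leq y$ and $x\neq y$. Put $I^+(x)=\{y: x\ll y\}$, $I^-(x)=\{y: y\ll x\}$, $J^+(x)=\{y: x\leq y\}$, $J^-(x)=\{y: y\leq x\}$, $J(x,y)=J^+(x)\cap J^-(y)$. **Lorentzian pre-length space** $(X,\ll,\leq,d,\tau)$: a causal space with a distance (metric) $d$ on $X$ and a map $\tau\colon X\times X\to[0,\infty]$ (the time separation function) such that (i) $\tau$ is lower semicontinuous for the topology of $d$; (ii) $\tau(x,z)\geq\tau(x,y)+\tau(y,z)$ whenever $x\leq y\leq z$; (iii) $\tau(x,y)>0$ iff $x\ll y$; (iv) $\tau(x,y)=0$ if $x\not\leq y$. All topological notions refer to $d$. **Curves.** A future-directed causal (resp. timelike) curve is a non-constant locally Lipschitz map $\gamma\colon I\to X$ on an interval $I$ with $\gamma(t_1)\leq\gamma(t_2)$ (resp. $\gamma(t_1)\ll\gamma(t_2)$) for all $t_1<t_2$ in $I$; past-directed curves are defined with the relations reversed. The $d$-length of $\gamma\colon[a,b]\to X$ is $L^d(\gamma)=\sup\sum_{i=0}^{n-1}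 d(\gamma(t_i),\gamma(t_{i+1}))$ over all partitions $a=t_0<\dots<t_n=b$. For a future-directed causal curve $\gamma\colon[a,b]\to X$ the $\tau$-length is $L_\tau(\gamma)=\inf\sum_{i=0}^{n-1}\tau(\gamma(t_i),\gamma(t_{i+1}))$ over all partitions $a=t_0<\dots<t_n=b$; for a past-directed one, use $\tau(\gamma(t_{i+1}),\gamma(t_i))$. A future-directed causal curve $\gamma\colon [a,b]\to X$ is maximal if $L_\tau(\gamma)=\tau(\gamma(a),\gamma(b))$ (for past-directed: $L_\tau(\gamma)=\tau(\gamma(b),\gamma(a))$). A causal curve $\gamma\colon I\to X$ is a geodesic if each $t\in I$ has a neighborhood $[a,b]\subset I$ (relative to $I$) such that $\gamma|_{[a,b]}$ is maximal. **Lorentzian length space.** A Lorentzian pre-length space that is: (a) causally path connected: if $x\ll y$ there is a future-directed timelike curve from $x$ to $y$, and if $x<y$ there is a future-directed causal curve from $x$ to $y$; (b) locally (weakly) causally closed: each point has a neighborhood $U$ such that whenever $p_n,q_n\in U$, $p_n\leq_U q_n$ for all $n$, $p_n\to p\in U$, $q_n\to q\in U$, then $p\leq_U q$, where $p\leq_U q$ means $p=q$ or there is a future-directed causal curve from $p$ to $q$ contained in $U$; (c) localizable: each $x\in X$ has an open neighborhood $\Omega_x$ such that (i) there is $C>0$ with $L^d(\gamma)\leq C$ for all causal curves $\gamma$ contained in $\Omega_x$; (ii) there is a continuous map $\omega_x\colon\Omega_x\times\Omega_x\to[0,\infty)$ such that $\Omega_x$ with the restrictions of $\ll,\leq,d$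 and with $\omega_x$ is a Lorentzian pre-length space, and $I^\pm(y)\cap\Omega_x\neq\emptyset$ for every $y\in\Omega_x$; (iii) for all $p<q$ in $\Omega_x$ there is a future-directed causal curve $\gamma_{p,q}$ from $p$ to $q$ with $L_\tau(\gamma_{p,q})\geq L_\tau(\lambda)$ for all future-directed causal curves $\lambda$ from $p$ to $q$ contained in $\Omega_x$, and $L_\tau(\gamma_{p,q})=\omega_x(p,q)\leq\tau(p,q)$; (d) such that for all $x,y$, $\tau(x,y)=\sup L_\tau(\gamma)$ over all future-directed causal curves $\gamma$ from $x$ to $y$ if there is such a curve, and $\tau(x,y)=0$ otherwise. **Globally hyperbolic**: (1) non-totally imprisoning, i.e. for every compact $K\subset X$ there is $C>0$ such that the $d$-length of all causal curves in $K$ is bounded by $C$; and (2) $J(x,y)$ is compact for all $x,y\in X$. **Finitely compact**: for every $B>0$, all $p,q\in X$ and every sequence $(x_n)$ in $X$ with $p\ll q\leq x_n$ and $\tau(p,x_n)\leq B$ for all $n$ (resp. $x_n\leq q\ll p$ and $\tau(x_n,p)\leq B$ for all $n$), the sequence $(x_n)$ has an accumulation point in $X$. Both versions are required. **Timelike Cauchy complete**: for every sequence $(x_n)_{n\geq1}$ in $X$ and every sequence of non-negative numbers $B_n\to0$ with $x_n\ll x_{n+1}$ and $\tau(x_n,x_{n+m})\leq B_n$ for all $n,m\geq 1$ (resp. $x_{n+1}\ll x_n$ and $\tau(x_{n+m},x_n)\leq B_n$ for all $n,m\ge 1$), the sequence $(x_n)$ converges in $X$. Both versions are required. **Inextendibility.**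 Let $-\infty<a<b\leq\infty$. A future-directed causal (resp. timelike) curve $\gamma\colon[a,b)\to X$ is future extendible if there exists a future-directed causal (resp. timelike) curve $\tilde\gamma\colon[a,b]\to X$ with $\tilde\gamma|_{[a,b)}=\gamma$. It is future inextendible if it is not future extendible. Past (in)extendibility is defined similarly. **Condition A**: for all $c\in[0,\infty]$, all $x,y\in X$ with $x\ll y$ (resp. $y\ll x$) and every future inextendible future-directed (resp. past inextendible past-directed) causal geodesic $\gamma$ starting at $y$ and defined on $[0,c)$, one has $\tau(x,\gamma(t))\to\infty$ (resp. $\tau(\gamma(t),x)\to\infty$) as $t\to c$. Both versions are required.
   Formalization: In Condition A, (in)extendibility is taken up to a strictly increasing reparametrization onto a bounded interval; in the fixed parametrization (2) fails in Minkowski space for t ↦ (−√(1−t),0) on [0,1), and extension to [a,∞] is undefined. *)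

theory Defs
  imports "HOL-Analysis.Analysis"
begin

text \<open>
  The ambient set \<open>X\<close> is the whole type \<open>'a::metric_space\<close> and \<open>d\<close> is \<^const>\<open>dist\<close>; \<open>ll\<close>, \<open>le\<close> and
  \<open>tau\<close> render the relations and the time separation function. Notions that also have to be
  evaluated on a neighbourhood carry an explicit set \<open>S\<close>.

  Past-directed notions are the future-directed ones for the time-reversed data \<open>ll\<inverse>\<inverse>\<close>, \<open>le\<inverse>\<inverse>\<close>
  and \<open>\<lambda>x y. tau y x\<close>.
\<close>

subsection \<open>Lorentzian pre-length spaces\<close>

definition causal_space_on :: "'a set \<Rightarrow> ('a \<Rightarrow> 'a \<Rightarrow> bool) \<Rightarrow> ('a \<Rightarrow> 'a \<Rightarrow> bool) \<Rightarrow> bool" where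
  "causal_space_on S ll le \<longleftrightarrow>
     transp_on S ll \<and> transp_on S le \<and> reflp_on S le \<and> (\<forall>x\<in>S. \<forall>y\<in>S. ll x y \<longrightarrow> le x y)"

definition lower_semicontinuous_on ::
  "'b::topological_space set \<Rightarrow> ('b \<Rightarrow> ennreal) \<Rightarrow> bool" where
  "lower_semicontinuous_on A f \<longleftrightarrow> (\<forall>c. openin (top_of_set A) {p\<in>A. c < f p})"

definition lorentzian_pre_length_space_on ::
  "'a::metric_space set \<Rightarrow> ('a \<Rightarrow> 'a \<Rightarrow> bool) \<Rightarrow> ('a \<Rightarrow> 'a \<Rightarrow> bool) \<Rightarrow> ('a \<Rightarrow> 'a \<Rightarrow> ennreal) \<Rightarrow> bool" where
  "lorentzian_pre_length_space_on S ll le tau \<longleftrightarrow>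
     causal_space_on S ll le \<and>
     lower_semicontinuous_on (S \<times> S) (\<lambda>(x, y). tau x y) \<and>
     (\<forall>x\<in>S. \<forall>y\<in>S. \<forall>z\<in>S. le x y \<and> le y z \<longrightarrow> tau x z \<ge> tau x y + tau y z) \<and>
     (\<forall>x\<in>S. \<forall>y\<in>S. tau x y > 0 \<longleftrightarrow> ll x y) \<and>
     (\<forall>x\<in>S. \<forall>y\<in>S. \<not> le x y \<longrightarrow> tau x y = 0)"

definition causal_diamond :: "('a \<Rightarrow> 'a \<Rightarrow> bool) \<Rightarrow> 'a \<Rightarrow> 'a \<Rightarrow> 'a set" where
  "causal_diamond le x y = {z. le x z} \<inter> {z. le z y}"

subsection \<open>Curves\<close>

text \<open>With \<open>R = le\<close> these are the future-directed causal curves, with \<open>R = ll\<close> the future-directed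
  timelike ones, and with \<open>R = le\<inverse>\<inverse>\<close>, \<open>R = ll\<inverse>\<inverse>\<close> the past-directed ones. A curve on the interval
  \<open>I\<close> is a total function of which only the values on \<open>I\<close> matter.\<close>

definition directed_curve ::
  "('a \<Rightarrow> 'a \<Rightarrow> bool) \<Rightarrow> real set \<Rightarrow> (real \<Rightarrow> 'a::metric_space) \<Rightarrow> bool" where
  "directed_curve R I \<gamma> \<longleftrightarrow>
     is_interval I \<and>
     (\<exists>s\<in>I. \<exists>t\<in>I. \<gamma> s \<noteq> \<gamma> t) \<and>
     (\<forall>t\<in>I. \<exists>e>0. \<exists>C. C-lipschitz_on (ball t e \<inter> I) \<gamma>) \<and>
     (\<forall>t1\<in>I. \<forall>t2\<in>I. t1 < t2 \<longrightarrow> R (\<gamma> t1) (\<gamma> t2))"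

definition directed_curve_from_to ::
  "('a \<Rightarrow> 'a \<Rightarrow> bool) \<Rightarrow> 'a \<Rightarrow> 'a \<Rightarrow> real \<Rightarrow> real \<Rightarrow> (real \<Rightarrow> 'a::metric_space) \<Rightarrow> bool" where
  "directed_curve_from_to R x y a b \<gamma> \<longleftrightarrow> directed_curve R {a..b} \<gamma> \<and> \<gamma> a = x \<and> \<gamma> b = y"

definition causal_curve ::
  "('a \<Rightarrow> 'a \<Rightarrow> bool) \<Rightarrow> real set \<Rightarrow> (real \<Rightarrow> 'a::metric_space) \<Rightarrow> bool" where
  "causal_curve le I \<gamma> \<longleftrightarrow> directed_curve le I \<gamma> \<or> directed_curve le\<inverse>\<inverse> I \<gamma>"

definition partitions :: "real \<Rightarrow> real \<Rightarrow> (nat \<times> (nat \<Rightarrow> real)) set" where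
  "partitions a b = {(n, t). t 0 = a \<and> t n = b \<and> (\<forall>i<n. t i < t (Suc i))}"

definition d_length :: "real \<Rightarrow> real \<Rightarrow> (real \<Rightarrow> 'a::metric_space) \<Rightarrow> ennreal" where
  "d_length a b \<gamma> =
     (SUP (n, t)\<in>partitions a b. \<Sum>i<n. ennreal (dist (\<gamma> (t i)) (\<gamma> (t (Suc i)))))"

definition tau_length :: "('a \<Rightarrow> 'a \<Rightarrow> ennreal) \<Rightarrow> real \<Rightarrow> real \<Rightarrow> (real \<Rightarrow> 'a) \<Rightarrow> ennreal" where
  "tau_length tau a b \<gamma> = (INF (n, t)\<in>partitions a b. \<Sum>i<n. tau (\<gamma> (t i)) (\<gamma> (t (Suc i))))"

definition maximal_curve ::
  "('a \<Rightarrow> 'a \<Rightarrow> bool) \<Rightarrow> ('a \<Rightarrow> 'a \<Rightarrow> ennreal) \<Rightarrow> real \<Rightarrow> real \<Rightarrow> (real \<Rightarrow> 'a::metric_space) \<Rightarrow> bool" where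
  "maximal_curve le tau a b \<gamma> \<longleftrightarrow>
     directed_curve le {a..b} \<gamma> \<and> tau_length tau a b \<gamma> = tau (\<gamma> a) (\<gamma> b)"

definition causal_geodesic ::
  "('a \<Rightarrow> 'a \<Rightarrow> bool) \<Rightarrow> ('a \<Rightarrow> 'a \<Rightarrow> ennreal) \<Rightarrow> real set \<Rightarrow> (real \<Rightarrow> 'a::metric_space) \<Rightarrow> bool" where
  "causal_geodesic le tau I \<gamma> \<longleftrightarrow>
     directed_curve le I \<gamma> \<and>
     (\<forall>t\<in>I. \<exists>a b. {a..b} \<subseteq> I \<and> (\<exists>V. open V \<and> t \<in> V \<and> V \<inter> I \<subseteq> {a..b}) \<and>
        maximal_curve le tau a b \<gamma>)"

subsection \<open>Lorentzian length spaces\<close>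

definition causally_path_connected ::
  "('a::metric_space \<Rightarrow> 'a \<Rightarrow> bool) \<Rightarrow> ('a \<Rightarrow> 'a \<Rightarrow> bool) \<Rightarrow> bool" where
  "causally_path_connected ll le \<longleftrightarrow>
     (\<forall>x y. ll x y \<longrightarrow> (\<exists>a b \<gamma>. directed_curve_from_to ll x y a b \<gamma>)) \<and>
     (\<forall>x y. le x y \<and> x \<noteq> y \<longrightarrow> (\<exists>a b \<gamma>. directed_curve_from_to le x y a b \<gamma>))"

definition le_within ::
  "('a::metric_space \<Rightarrow> 'a \<Rightarrow> bool) \<Rightarrow> 'a set \<Rightarrow> 'a \<Rightarrow> 'a \<Rightarrow> bool" where
  "le_within le U p q \<longleftrightarrow>
     p = q \<or> (\<exists>a b \<gamma>. directed_curve_from_to le p q a b \<gamma> \<and> \<gamma> ` {a..b} \<subseteq> U)"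

definition locally_causally_closed :: "('a::metric_space \<Rightarrow> 'a \<Rightarrow> bool) \<Rightarrow> bool" where
  "locally_causally_closed le \<longleftrightarrow>
     (\<forall>x. \<exists>U. x \<in> interior U \<and>
        (\<forall>(p::nat \<Rightarrow> 'a) q p' q'.
           (\<forall>n. p n \<in> U \<and> q n \<in> U \<and> le_within le U (p n) (q n)) \<and>
           p' \<in> U \<and> q' \<in> U \<and> p \<longlonglongrightarrow> p' \<and> q \<longlonglongrightarrow> q' \<longrightarrow> le_within le U p' q'))"

definition localizing_neighbourhood ::
  "('a::metric_space \<Rightarrow> 'a \<Rightarrow> bool) \<Rightarrow> ('a \<Rightarrow> 'a \<Rightarrow> bool) \<Rightarrow> ('a \<Rightarrow> 'a \<Rightarrow> ennreal) \<Rightarrow> 'a \<Rightarrow> 'a set \<Rightarrow> bool" where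
  "localizing_neighbourhood ll le tau x \<Omega> \<longleftrightarrow>
     open \<Omega> \<and> x \<in> \<Omega> \<and>
     (\<exists>C>0. \<forall>a b \<gamma>. causal_curve le {a..b} \<gamma> \<and> \<gamma> ` {a..b} \<subseteq> \<Omega> \<longrightarrow> d_length a b \<gamma> \<le> ennreal C) \<and>
     (\<exists>\<omega> :: 'a \<Rightarrow> 'a \<Rightarrow> real.
        (\<forall>p\<in>\<Omega>. \<forall>q\<in>\<Omega>. 0 \<le> \<omega> p q) \<and>
        continuous_on (\<Omega> \<times> \<Omega>) (\<lambda>(p, q). \<omega> p q) \<and>
        lorentzian_pre_length_space_on \<Omega> ll le (\<lambda>p q. ennreal (\<omega> p q)) \<and>
        (\<forall>y\<in>\<Omega>. {z. ll y z} \<inter> \<Omega> \<noteq> {} \<and> {z. ll z y} \<inter> \<Omega> \<noteq> {}) \<and>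
        (\<forall>p\<in>\<Omega>. \<forall>q\<in>\<Omega>. le p q \<and> p \<noteq> q \<longrightarrow>
           (\<exists>a b \<gamma>. directed_curve_from_to le p q a b \<gamma> \<and>
              (\<forall>a' b' \<sigma>. directed_curve_from_to le p q a' b' \<sigma> \<and> \<sigma> ` {a'..b'} \<subseteq> \<Omega> \<longrightarrow>
                 tau_length tau a b \<gamma> \<ge> tau_length tau a' b' \<sigma>) \<and>
              tau_length tau a b \<gamma> = ennreal (\<omega> p q) \<and> ennreal (\<omega> p q) \<le> tau p q)))"

definition localizable ::
  "('a::metric_space \<Rightarrow> 'a \<Rightarrow> bool) \<Rightarrow> ('a \<Rightarrow> 'a \<Rightarrow> bool) \<Rightarrow> ('a \<Rightarrow> 'a \<Rightarrow> ennreal) \<Rightarrow> bool" where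
  "localizable ll le tau \<longleftrightarrow> (\<forall>x. \<exists>\<Omega>. localizing_neighbourhood ll le tau x \<Omega>)"

text \<open>The last clause covers the case that no causal curve joins \<open>x\<close> to \<open>y\<close>, since the supremum
  of the empty set is \<open>0\<close> in \<^typ>\<open>ennreal\<close>.\<close>

definition lorentzian_length_space ::
  "('a::metric_space \<Rightarrow> 'a \<Rightarrow> bool) \<Rightarrow> ('a \<Rightarrow> 'a \<Rightarrow> bool) \<Rightarrow> ('a \<Rightarrow> 'a \<Rightarrow> ennreal) \<Rightarrow> bool" where
  "lorentzian_length_space ll le tau \<longleftrightarrow>
     lorentzian_pre_length_space_on UNIV ll le tau \<and>
     causally_path_connected ll le \<and>
     locally_causally_closed le \<and>
     localizable ll le tau \<and>
     (\<forall>x y. tau x y = Sup {tau_length tau a b \<gamma> | a b \<gamma>. directed_curve_from_to le x y a b \<gamma>})"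

definition non_totally_imprisoning :: "('a::metric_space \<Rightarrow> 'a \<Rightarrow> bool) \<Rightarrow> bool" where
  "non_totally_imprisoning le \<longleftrightarrow>
     (\<forall>K. compact K \<longrightarrow>
        (\<exists>C>0. \<forall>a b \<gamma>. causal_curve le {a..b} \<gamma> \<and> \<gamma> ` {a..b} \<subseteq> K \<longrightarrow> d_length a b \<gamma> \<le> ennreal C))"

definition globally_hyperbolic :: "('a::metric_space \<Rightarrow> 'a \<Rightarrow> bool) \<Rightarrow> bool" where
  "globally_hyperbolic le \<longleftrightarrow>
     non_totally_imprisoning le \<and> (\<forall>x y. compact (causal_diamond le x y))"

subsection \<open>Completeness conditions\<close>

definition has_accumulation_point :: "(nat \<Rightarrow> 'a::topological_space) \<Rightarrow> bool" where
  "has_accumulation_point x \<longleftrightarrow> (\<exists>l r. strict_mono (r :: nat \<Rightarrow> nat) \<and> (x \<circ> r) \<longlonglongrightarrow> l)"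

definition finitely_compact ::
  "('a::metric_space \<Rightarrow> 'a \<Rightarrow> bool) \<Rightarrow> ('a \<Rightarrow> 'a \<Rightarrow> bool) \<Rightarrow> ('a \<Rightarrow> 'a \<Rightarrow> ennreal) \<Rightarrow> bool" where
  "finitely_compact ll le tau \<longleftrightarrow>
     (\<forall>(B::real) p q x. B > 0 \<and> ll p q \<and> (\<forall>n. le q (x n) \<and> tau p (x n) \<le> ennreal B) \<longrightarrow>
        has_accumulation_point x) \<and>
     (\<forall>(B::real) p q x. B > 0 \<and> ll q p \<and> (\<forall>n. le (x n) q \<and> tau (x n) p \<le> ennreal B) \<longrightarrow>
        has_accumulation_point x)"

definition timelike_Cauchy_complete ::
  "('a::metric_space \<Rightarrow> 'a \<Rightarrow> bool) \<Rightarrow> ('a \<Rightarrow> 'a \<Rightarrow> ennreal) \<Rightarrow> bool" where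
  "timelike_Cauchy_complete ll tau \<longleftrightarrow>
     (\<forall>(x :: nat \<Rightarrow> 'a) (B :: nat \<Rightarrow> real).
        (\<forall>n\<ge>1. 0 \<le> B n) \<and> B \<longlonglongrightarrow> 0 \<and> (\<forall>n\<ge>1. ll (x n) (x (n + 1))) \<and>
        (\<forall>n\<ge>1. \<forall>m\<ge>1. tau (x n) (x (n + m)) \<le> ennreal (B n)) \<longrightarrow> convergent x) \<and>
     (\<forall>(x :: nat \<Rightarrow> 'a) (B :: nat \<Rightarrow> real).
        (\<forall>n\<ge>1. 0 \<le> B n) \<and> B \<longlonglongrightarrow> 0 \<and> (\<forall>n\<ge>1. ll (x (n + 1)) (x n)) \<and>
        (\<forall>n\<ge>1. \<forall>m\<ge>1. tau (x (n + m)) (x n) \<le> ennreal (B n)) \<longrightarrow> convergent x)"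

definition half_open :: "real \<Rightarrow> ereal \<Rightarrow> real set" where
  "half_open a b = {t. a \<le> t \<and> ereal t < b}"

text \<open>
  Extendibility of a curve \<open>\<gamma>\<close> on \<open>[a, b)\<close> with \<open>b \<le> \<infinity>\<close> is understood up to reparametrisation:
  after a strictly increasing change of parameter \<open>\<phi> : [a', b') \<rightarrow> [a, b)\<close> onto a bounded interval,
  the curve extends to a (locally Lipschitz) curve \<open>\<gamma>'\<close> of the same kind on \<open>[a', b']\<close>. For \<open>b = \<infinity>\<close>
  this gives a meaning to curves on \<open>[a, \<infinity>]\<close>. For \<open>b < \<infinity>\<close> the case \<open>\<phi> = id\<close> is extension in the
  given parameter; allowing other \<open>\<phi>\<close> keeps inextendibility a property of the unparametrised
  curve. Otherwise a segment such as \<open>t \<mapsto> - sqrt (1 - t)\<close> on \<open>[0, 1)\<close> of the time axis of Minkowski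
  space, which ends at a point of the space, would count as inextendible merely because its
  parametrisation is not Lipschitz at \<open>1\<close>.
\<close>

definition extendible ::
  "('a \<Rightarrow> 'a \<Rightarrow> bool) \<Rightarrow> real \<Rightarrow> ereal \<Rightarrow> (real \<Rightarrow> 'a::metric_space) \<Rightarrow> bool" where
  "extendible R a b \<gamma> \<longleftrightarrow>
     (\<exists>a' b' \<phi> \<gamma>'. a' < b' \<and>
        strict_mono_on {a'..<b'} \<phi> \<and> \<phi> ` {a'..<b'} = half_open a b \<and>
        directed_curve R {a'..b'} \<gamma>' \<and> (\<forall>s\<in>{a'..<b'}. \<gamma>' s = \<gamma> (\<phi> s)))"

definition inextendible_causal_geodesic ::
  "('a \<Rightarrow> 'a \<Rightarrow> bool) \<Rightarrow> ('a \<Rightarrow> 'a \<Rightarrow> ennreal) \<Rightarrow> ereal \<Rightarrow> (real \<Rightarrow> 'a::metric_space) \<Rightarrow> bool" where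
  "inextendible_causal_geodesic le tau c \<gamma> \<longleftrightarrow>
     causal_geodesic le tau (half_open 0 c) \<gamma> \<and> \<not> extendible le 0 c \<gamma>"

definition condition_A ::
  "('a::metric_space \<Rightarrow> 'a \<Rightarrow> bool) \<Rightarrow> ('a \<Rightarrow> 'a \<Rightarrow> bool) \<Rightarrow> ('a \<Rightarrow> 'a \<Rightarrow> ennreal) \<Rightarrow> bool" where
  "condition_A ll le tau \<longleftrightarrow>
     (\<forall>c x y \<gamma>. 0 \<le> c \<and> ll x y \<and>
        inextendible_causal_geodesic le tau c \<gamma> \<and> \<gamma> 0 = y \<longrightarrow>
        ((\<lambda>t. tau x (\<gamma> (real_of_ereal t))) \<longlongrightarrow> \<infinity>) (at_left c)) \<and>
     (\<forall>c x y \<gamma>. 0 \<le> c \<and> ll y x \<and>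
        inextendible_causal_geodesic le\<inverse>\<inverse> (\<lambda>p q. tau q p) c \<gamma> \<and> \<gamma> 0 = y \<longrightarrow>
        ((\<lambda>t. tau (\<gamma> (real_of_ereal t)) x) \<longlongrightarrow> \<infinity>) (at_left c))"

end

theory Submission
  imports Defs
begin

text \<open>
  If a future-directed causal curve \<open>\<gamma>\<close> on \<open>[0, c)\<close> starts in the future of \<open>x\<close> and
  \<open>\<tau>(x, \<gamma>(t))\<close> stays bounded, choose \<open>t\<^sub>n\<close> increasing to \<open>c\<close> and a chronological sequence
  \<open>x\<^sub>n \<lless> \<gamma>(t\<^sub>n)\<close> whose distance to \<open>\<gamma>(t\<^sub>n)\<close> tends to \<open>0\<close>; this also works when \<open>\<gamma>\<close> is null. By
  the reverse triangle inequality \<open>\<tau>(x, x\<^sub>n)\<close> is increasing and bounded, so \<open>(x\<^sub>n)\<close> is a timelike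
  Cauchy sequence, and its limit is a limit of \<open>\<gamma>(t\<^sub>n)\<close>. Hence \<open>\<gamma>\<close> stays in a compact diamond, has
  finite length, and extends after reparametrisation by arc length.

  A chronological sequence with an accumulation point lies in a compact diamond; any two of its
  accumulation points precede each other causally, so they agree by antisymmetry, which follows
  from non-total imprisonment.
\<close>

subsection \<open>Curves\<close>

lemma directed_curve_continuous_on:
  assumes "directed_curve R I \<gamma>"
  shows "continuous_on I \<gamma>"
  unfolding continuous_on_eq_continuous_within
proof
  fix t assume t: "t \<in> I"
  obtain e L where e: "e > 0" and L: "L-lipschitz_on (ball t e \<inter> I) \<gamma>"
    using assms t unfolding directed_curve_def by blast
  have "continuous (at t within ball t e \<inter> I) \<gamma>"
    using lipschitz_on_continuous_on[OF L] t e by (auto simp: continuous_on_eq_continuous_within)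
  then show "continuous (at t within I) \<gamma>"
    using at_within_nhd[of t "ball t e" "ball t e \<inter> I" I] e by (auto simp: Int_ac)
qed

lemma sum_chain_eq_sum_partition:
  fixes p :: "nat \<Rightarrow> real" and F :: "real \<Rightarrow> real \<Rightarrow> 'b::comm_monoid_add"
  assumes F: "\<And>t. F t t = 0" and p: "\<And>i. i < n \<Longrightarrow> p i \<le> p (Suc i)"
  shows "\<exists>(m, q)\<in>partitions (p 0) (p n). (\<Sum>i<m. F (q i) (q (Suc i))) = (\<Sum>i<n. F (p i) (p (Suc i)))"
  using p
proof (induction n)
  case 0
  have "(0, \<lambda>_. p 0) \<in> partitions (p 0) (p 0)" by (simp add: partitions_def)
  then show ?case by force
next
  case (Suc n)
  have "\<exists>(m, q)\<in>partitions (p 0) (p n).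
      (\<Sum>i<m. F (q i) (q (Suc i))) = (\<Sum>i<n. F (p i) (p (Suc i)))"
    by (rule Suc.IH) (simp add: Suc.prems)
  then obtain m q where q: "(m, q) \<in> partitions (p 0) (p n)"
    and eq: "(\<Sum>i<m. F (q i) (q (Suc i))) = (\<Sum>i<n. F (p i) (p (Suc i)))"
    by blast
  show ?case
  proof (cases "p n = p (Suc n)")
    case True
    then show ?thesis using q eq F by (intro bexI[of _ "(m, q)"]) auto
  next
    case False
    then have lt: "p n < p (Suc n)" using Suc.prems[of n] by simp
    let ?q = "q(Suc m := p (Suc n))"
    have "(Suc m, ?q) \<in> partitions (p 0) (p (Suc n))"
      using q lt by (auto simp: partitions_def less_Suc_eq)
    moreover have "(\<Sum>i<Suc m. F (?q i) (?q (Suc i))) = (\<Sum>i<Suc n. F (p i) (p (Suc i)))"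
      using q eq by (simp add: partitions_def)
    ultimately show ?thesis by blast
  qed
qed

text \<open>Turns a length bound in \<open>ennreal\<close> into a bound on finite real sums;
  \<open>0 \<le> C\<close> matters because \<open>ennreal\<close> sends negative numbers to
  \<open>0\<close>.\<close>

lemma sum_dist_chain_le:
  fixes \<gamma> :: "real \<Rightarrow> 'a::metric_space"
  assumes "d_length a (p n) \<gamma> \<le> ennreal C" "0 \<le> C" "p 0 = a" "\<And>i. i < n \<Longrightarrow> p i \<le> p (Suc i)"
  shows "(\<Sum>i<n. dist (\<gamma> (p i)) (\<gamma> (p (Suc i)))) \<le> C"
proof -
  obtain m q where q: "(m, q) \<in> partitions a (p n)"
    and eq: "(\<Sum>i<m. dist (\<gamma> (q i)) (\<gamma> (q (Suc i)))) = (\<Sum>i<n. dist (\<gamma> (p i)) (\<gamma> (p (Suc i))))"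
    using sum_chain_eq_sum_partition[of "\<lambda>s t. dist (\<gamma> s) (\<gamma> t)" n p] assms(3,4) by auto
  have "ennreal (\<Sum>i<m. dist (\<gamma> (q i)) (\<gamma> (q (Suc i)))) =
      (\<Sum>i<m. ennreal (dist (\<gamma> (q i)) (\<gamma> (q (Suc i)))))"
    by (simp add: sum_ennreal)
  also have "\<dots> \<le> d_length a (p n) \<gamma>"
    unfolding d_length_def using q by (intro SUP_upper2[of "(m, q)"]) auto
  also have "\<dots> \<le> ennreal C" by fact
  finally show ?thesis using eq \<open>0 \<le> C\<close> by (simp add: ennreal_le_iff)
qed

section \<open>Reparametrisation by arc length\<close>

text \<open>The new parameter is arc length plus a bounded strictly increasing term. Distances along
  \<open>\<gamma>\<close> are at most parameter differences, so the new curve is 1-Lipschitz, and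
  bounded length makes the parameter interval bounded even when \<open>c\<close> is
  infinite.\<close>

lemma arc_length_reparametrisation:
  fixes \<gamma> :: "real \<Rightarrow> 'a::metric_space" and a :: real and c :: ereal
  assumes c: "ereal a < c"
    and lip: "\<And>t. t \<in> half_open a c \<Longrightarrow> \<exists>e>0. \<exists>L. L-lipschitz_on (ball t e \<inter> half_open a c) \<gamma>"
    and bdd: "\<And>n p. p 0 = a \<Longrightarrow> (\<And>i. i < n \<Longrightarrow> p i \<le> p (Suc i)) \<Longrightarrow> p n \<in> half_open a c \<Longrightarrow>
      (\<Sum>i<n. dist (\<gamma> (p i)) (\<gamma> (p (Suc i)))) \<le> C"
  obtains b :: real and \<phi> where "0 < b" "strict_mono_on {0..<b} \<phi>" "\<phi> ` {0..<b} = half_open a c"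
    "1-lipschitz_on {0..<b} (\<gamma> \<circ> \<phi>)"
proof -
  let ?I = "half_open a c"
  \<comment> \<open>\<open>W t\<close> collects the lengths of inscribed polygons up to
    \<open>t\<close>, so \<open>V t\<close> is the length of \<open>\<gamma>\<close> on
    \<open>[a, t]\<close>.\<close>
  define W where "W t = {\<Sum>i<n. dist (\<gamma> (p i)) (\<gamma> (p (Suc i))) | n p.
    p 0 = a \<and> p n = t \<and> (\<forall>i<n. p i \<le> p (Suc i))}" for t
  define V where "V t = Sup (W t)" for t
  have W_le: "w \<le> C" if "w \<in> W t" "t \<in> ?I" for w t
    using that bdd unfolding W_def by auto
  have bdd_W: "bdd_above (W t)" if "t \<in> ?I" for t
    using W_le[OF _ that] by (meson bdd_aboveI)
  have W_app: "w + dist (\<gamma> s) (\<gamma> t) \<in> W t" if "w \<in> W s" "s \<le> t" for w s t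
  proof -
    obtain n p where p: "w = (\<Sum>i<n. dist (\<gamma> (p i)) (\<gamma> (p (Suc i))))"
      "p 0 = a" "p n = s" "\<forall>i<n. p i \<le> p (Suc i)"
      using \<open>w \<in> W s\<close> unfolding W_def by auto
    let ?p = "p(Suc n := t)"
    have "w + dist (\<gamma> s) (\<gamma> t) = (\<Sum>i<Suc n. dist (\<gamma> (?p i)) (\<gamma> (?p (Suc i))))"
      "?p 0 = a" "?p (Suc n) = t" "\<forall>i<Suc n. ?p i \<le> ?p (Suc i)"
      using p that by (auto simp: less_Suc_eq)
    then show ?thesis unfolding W_def by blast
  qed
  have W_a: "0 \<in> W a"
    unfolding W_def by (rule CollectI, rule exI[of _ 0], rule exI[of _ "\<lambda>_. a"]) simp
  have W_ne: "W t \<noteq> {}" if "t \<in> ?I" for t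
    using W_app[OF W_a, of t] that by (auto simp: half_open_def)
  have V_le_C: "V t \<le> C" if "t \<in> ?I" for t
    unfolding V_def by (rule cSup_least[OF W_ne[OF that] W_le[OF _ that]])
  have V_dist: "V s + dist (\<gamma> s) (\<gamma> t) \<le> V t" if "s \<in> ?I" "t \<in> ?I" "s \<le> t" for s t
  proof -
    have "V s \<le> V t - dist (\<gamma> s) (\<gamma> t)"
      unfolding V_def
    proof (rule cSup_least[OF W_ne[OF \<open>s \<in> ?I\<close>]])
      fix w assume "w \<in> W s"
      from cSup_upper[OF W_app[OF this \<open>s \<le> t\<close>] bdd_W[OF \<open>t \<in> ?I\<close>]]
      show "w \<le> Sup (W t) - dist (\<gamma> s) (\<gamma> t)" by simp
    qed
    then show ?thesis by simp
  qed
  have V_lip: "V t \<le> V s + L * (t - s)"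
    if st: "s \<in> ?I" "t \<in> ?I" "s \<le> t" and L: "L-lipschitz_on {s..t} \<gamma>" for s t L
    unfolding V_def[of t]
  proof (rule cSup_least[OF W_ne[OF \<open>t \<in> ?I\<close>]])
    fix w assume "w \<in> W t"
    then obtain n p where w: "w = (\<Sum>i<n. dist (\<gamma> (p i)) (\<gamma> (p (Suc i))))"
      and p: "p 0 = a" "p n = t" "\<forall>i<n. p i \<le> p (Suc i)"
      unfolding W_def by auto
    \<comment> \<open>Cut the chain at \<open>s\<close>: clipping by \<open>min\<close> leaves a
      chain from \<open>a\<close> to \<open>s\<close>, clipping by \<open>max\<close> one from
      \<open>s\<close> to \<open>t\<close>, whose share of the sum telescopes against
      \<open>L\<close>.\<close>
    define l where "l i = min (p i) s" for i
    define u where "u i = max (p i) s" for i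
    have "i \<le> n \<longrightarrow> p i \<le> t" for i
    proof -
      have "i \<le> j \<Longrightarrow> j \<le> n \<Longrightarrow> p i \<le> p j" for j
        by (induction j rule: dec_induct) (use p(3) in \<open>auto intro: order_trans\<close>)
      then show ?thesis using p(2) by auto
    qed
    then have u_mem: "u i \<in> {s..t}" if "i \<le> n" for i
      using st that by (auto simp: u_def)
    have "w \<le> (\<Sum>i<n. dist (\<gamma> (l i)) (\<gamma> (l (Suc i))) + dist (\<gamma> (u i)) (\<gamma> (u (Suc i))))"
      unfolding w
    proof (rule sum_mono)
      fix i assume "i \<in> {..<n}"
      then have "p i \<le> p (Suc i)" using p by auto
      then consider "p (Suc i) \<le> s" | "s \<le> p i" | "p i \<le> s" "s \<le> p (Suc i)" by linarith
      then show "dist (\<gamma> (p i)) (\<gamma> (p (Suc i))) \<le>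
          dist (\<gamma> (l i)) (\<gamma> (l (Suc i))) + dist (\<gamma> (u i)) (\<gamma> (u (Suc i)))"
      proof cases
        case 1
        then show ?thesis using \<open>p i \<le> p (Suc i)\<close> by (simp add: l_def)
      next
        case 2
        then show ?thesis using \<open>p i \<le> p (Suc i)\<close> by (simp add: u_def)
      next
        case 3
        then show ?thesis by (simp add: u_def l_def dist_triangle)
      qed
    qed
    also have "\<dots> = (\<Sum>i<n. dist (\<gamma> (l i)) (\<gamma> (l (Suc i)))) + (\<Sum>i<n. dist (\<gamma> (u i)) (\<gamma> (u (Suc i))))"
      by (rule sum.distrib)
    also have "(\<Sum>i<n. dist (\<gamma> (l i)) (\<gamma> (l (Suc i)))) \<le> V s"
      unfolding V_def
    proof (rule cSup_upper[OF _ bdd_W[OF \<open>s \<in> ?I\<close>]])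
      have "l 0 = a" "l n = s" "\<forall>i<n. l i \<le> l (Suc i)"
        using p st by (auto simp: l_def half_open_def min_def)
      then show "(\<Sum>i<n. dist (\<gamma> (l i)) (\<gamma> (l (Suc i)))) \<in> W s" unfolding W_def by blast
    qed
    also have "(\<Sum>i<n. dist (\<gamma> (u i)) (\<gamma> (u (Suc i)))) \<le> (\<Sum>i<n. L * (u (Suc i) - u i))"
    proof (rule sum_mono)
      fix i assume i: "i \<in> {..<n}"
      then have "u i \<le> u (Suc i)" using p by (auto simp: u_def max_def intro: order_trans)
      then show "dist (\<gamma> (u i)) (\<gamma> (u (Suc i))) \<le> L * (u (Suc i) - u i)"
        using lipschitz_onD[OF L u_mem[of i] u_mem[of "Suc i"]] i by (simp add: dist_real_def)
    qed
    also have "\<dots> = L * (u n - u 0)"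
      by (simp add: sum_distrib_left[symmetric] sum_lessThan_telescope)
    also have "\<dots> = L * (t - s)"
      using p st by (simp add: u_def half_open_def)
    finally show "w \<le> V s + L * (t - s)" by simp
  qed
  text \<open>The summand \<open>arctan\<close> makes the new parameter strictly increasing where \<open>\<gamma>\<close> is constant.\<close>
  define \<psi> where "\<psi> t = V t - V a + (arctan t - arctan a)" for t
  have a: "a \<in> ?I" using c by (simp add: half_open_def)
  have \<psi>_less: "\<psi> s < \<psi> t" if "s \<in> ?I" "t \<in> ?I" "s < t" for s t
    using V_dist[of s t] that arctan_less_iff[of s t] zero_le_dist[of "\<gamma> s" "\<gamma> t"]
    unfolding \<psi>_def by linarith
  have \<psi>_le: "\<psi> s \<le> \<psi> t" if "s \<in> ?I" "t \<in> ?I" "s \<le> t" for s t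
    using \<psi>_less[of s t] that by (cases "s = t") auto
  have \<psi>_dist: "dist (\<gamma> s) (\<gamma> t) \<le> \<psi> t - \<psi> s" if "s \<in> ?I" "t \<in> ?I" "s \<le> t" for s t
    using V_dist[of s t] that arctan_le_iff[of s t] unfolding \<psi>_def by linarith
  have conv: "{s..t} \<subseteq> ?I" if "s \<in> ?I" "t \<in> ?I" for s t
    using that unfolding half_open_def by (auto intro: le_less_trans[of _ "ereal t"])
  have \<psi>_cont: "continuous_on ?I \<psi>"
  proof -
    have "continuous_on ?I V"
      unfolding continuous_on_eq_continuous_within
    proof
      fix t assume t: "t \<in> ?I"
      obtain e L where e: "e > 0" and L: "L-lipschitz_on (ball t e \<inter> ?I) \<gamma>" using lip[OF t] by blast
      \<comment> \<open>\<open>V\<close> inherits the local Lipschitz constants of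
        \<open>\<gamma>\<close>, which gives its continuity.\<close>
      have one: "\<bar>V v - V u\<bar> \<le> L * \<bar>v - u\<bar>"
        if "u \<in> ball t e \<inter> ?I" "v \<in> ball t e \<inter> ?I" "u \<le> v" for u v
      proof -
        have "{u..v} \<subseteq> ball t e \<inter> ?I"
          using conv[of u v] that by (auto simp: dist_real_def)
        then have "V v \<le> V u + L * (v - u)"
          using V_lip[of u v L] lipschitz_on_subset[OF L] that by blast
        moreover have "V u + dist (\<gamma> u) (\<gamma> v) \<le> V v" using V_dist that by blast
        then have "V u \<le> V v" using zero_le_dist[of "\<gamma> u" "\<gamma> v"] by linarith
        ultimately show ?thesis using that by simp
      qed
      have "L-lipschitz_on (ball t e \<inter> ?I) V"
      proof (rule lipschitz_onI)
        fix u v assume "u \<in> ball t e \<inter> ?I" "v \<in> ball t e \<inter> ?I"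
        then show "dist (V u) (V v) \<le> L * dist u v"
          using one[of u v] one[of v u] by (cases "u \<le> v") (auto simp: dist_real_def abs_minus_commute)
      qed (use L in \<open>simp add: lipschitz_on_nonneg\<close>)
      then have "continuous (at t within ball t e \<inter> ?I) V"
        using lipschitz_on_continuous_on[of L "ball t e \<inter> ?I" V] t e
        by (simp add: continuous_on_eq_continuous_within)
      then show "continuous (at t within ?I) V"
        using at_within_nhd[of t "ball t e" "ball t e \<inter> ?I" ?I] e by (auto simp: Int_ac)
    qed
    then show ?thesis unfolding \<psi>_def by (intro continuous_intros)
  qed
  define b where "b = Sup (\<psi> ` ?I)"
  have \<psi>_bdd: "bdd_above (\<psi> ` ?I)"
  proof (rule bdd_aboveI2)
    fix t assume "t \<in> ?I"
    then show "\<psi> t \<le> C - V a + (pi / 2 - arctan a)"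
      using V_le_C[of t] arctan_ubound[of t] unfolding \<psi>_def by linarith
  qed
  \<comment> \<open>The half-open interval has no last point, so \<open>b\<close> is not attained
    and the image of \<open>\<psi>\<close> is \<open>[0, b)\<close>.\<close>
  have above: "\<exists>t'\<in>?I. t < t'" if t: "t \<in> ?I" for t
  proof -
    obtain r where "ereal t < ereal r" "ereal r < c"
      using t ereal_dense2[of "ereal t" c] by (auto simp: half_open_def)
    then show ?thesis using t by (auto simp: half_open_def intro!: exI[of _ r])
  qed
  have \<psi>_lt: "\<psi> t < b" if t: "t \<in> ?I" for t
  proof -
    obtain t' where "t' \<in> ?I" "t < t'" using above[OF t] by blast
    then have "\<psi> t < \<psi> t'" using \<psi>_less t by blast
    also have "\<dots> \<le> b" unfolding b_def by (rule cSup_upper[OF imageI[OF \<open>t' \<in> ?I\<close>] \<psi>_bdd])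
    finally show ?thesis .
  qed
  have \<psi>_a: "\<psi> a = 0" by (simp add: \<psi>_def)
  have img: "\<psi> ` ?I = {0..<b}"
  proof
    show "\<psi> ` ?I \<subseteq> {0..<b}"
      using \<psi>_lt \<psi>_le[OF a] \<psi>_a by (fastforce simp: half_open_def)
    show "{0..<b} \<subseteq> \<psi> ` ?I"
    proof
      fix s assume s: "s \<in> {0..<b}"
      then obtain t where t: "t \<in> ?I" "s < \<psi> t"
        using less_cSup_iff[OF _ \<psi>_bdd, of s] a unfolding b_def by auto
      then have "\<exists>x\<ge>a. x \<le> t \<and> \<psi> x = s"
        using s \<psi>_a by (intro IVT') (auto intro: continuous_on_subset[OF \<psi>_cont conv[OF a]] simp: half_open_def)
      then show "s \<in> \<psi> ` ?I" using conv[OF a t(1)] by auto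
    qed
  qed
  have inj: "inj_on \<psi> ?I"
    by (rule inj_onI) (metis \<psi>_less less_irrefl linorder_less_linear)
  define \<phi> where "\<phi> = the_inv_into ?I \<psi>"
  have \<phi>_mem: "\<phi> s \<in> ?I" and \<psi>_\<phi>: "\<psi> (\<phi> s) = s" if "s \<in> {0..<b}" for s
    using that img inj the_inv_into_into[of \<psi> ?I s ?I] f_the_inv_into_f[of \<psi> ?I s] unfolding \<phi>_def by auto
  have mono: "\<phi> s < \<phi> t" if "s \<in> {0..<b}" "t \<in> {0..<b}" "s < t" for s t
    using \<psi>_le[of "\<phi> t" "\<phi> s"] \<phi>_mem \<psi>_\<phi> that by (metis not_le)
  show ?thesis
  proof
    show "0 < b" using \<psi>_lt[OF a] \<psi>_a by simp
    show "strict_mono_on {0..<b} \<phi>" using mono by (intro strict_mono_onI) auto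
    show "\<phi> ` {0..<b} = ?I"
      unfolding \<phi>_def img[symmetric] by (rule the_inv_into_onto[OF inj])
    show "1-lipschitz_on {0..<b} (\<gamma> \<circ> \<phi>)"
    proof (rule lipschitz_onI)
      have *: "dist (\<gamma> (\<phi> s)) (\<gamma> (\<phi> t)) \<le> t - s" if "s \<in> {0..<b}" "t \<in> {0..<b}" "s \<le> t" for s t
        using \<psi>_dist[of "\<phi> s" "\<phi> t"] mono[of s t] \<phi>_mem \<psi>_\<phi> that by (cases "s = t") auto
      fix s t assume "s \<in> {0..<b}" "t \<in> {0..<b}"
      then show "dist ((\<gamma> \<circ> \<phi>) s) ((\<gamma> \<circ> \<phi>) t) \<le> 1 * dist s t"
        using *[of s t] *[of t s] by (cases "s \<le> t") (auto simp: dist_real_def dist_commute)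
    qed simp
  qed
qed

subsection \<open>Antisymmetry of the causal relation\<close>

text \<open>If \<open>x \<noteq> y\<close>, a causal curve from \<open>x\<close> to \<open>y\<close>
  together with \<open>le y x\<close> has causally equivalent points. Oscillating along its compact
  image gives causal curves of arbitrarily large length there, against non-total
  imprisonment.\<close>

lemma non_totally_imprisoning_antisym:
  fixes le :: "'a::metric_space \<Rightarrow> 'a \<Rightarrow> bool"
  assumes trans: "\<And>x y z. le x y \<Longrightarrow> le y z \<Longrightarrow> le x z" and refl: "\<And>x. le x x"
    and conn: "causally_path_connected ll le" and nti: "non_totally_imprisoning le"
    and xy: "le x y" "le y x"
  shows "x = y"
proof (rule ccontr)
  assume "x \<noteq> y"
  then obtain a b \<gamma> where \<gamma>: "directed_curve le {a..b} \<gamma>" "\<gamma> a = x" "\<gamma> b = y"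
    using conn xy unfolding causally_path_connected_def directed_curve_from_to_def by blast
  have ab: "a < b"
    using \<gamma>(1) unfolding directed_curve_def by (metis atLeastAtMost_iff not_le order_antisym order_trans)
  let ?K = "\<gamma> ` {a..b}"
  have "compact ?K" using directed_curve_continuous_on[OF \<gamma>(1)] by (intro compact_continuous_image) auto
  then obtain C where "C > 0"
    and C: "\<And>a' b' \<sigma>. causal_curve le {a'..b'} \<sigma> \<Longrightarrow> \<sigma> ` {a'..b'} \<subseteq> ?K \<Longrightarrow> d_length a' b' \<sigma> \<le> ennreal C"
    using nti unfolding non_totally_imprisoning_def by meson
  \<comment> \<open>Going backwards takes the detour from \<open>\<gamma> s\<close> on to
    \<open>y\<close>, then to \<open>x\<close> by \<open>le y x\<close>, and forward to
    \<open>\<gamma> t\<close>.\<close>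
  have le_\<gamma>: "le (\<gamma> s) (\<gamma> t)" if "s \<in> {a..b}" "t \<in> {a..b}" for s t
  proof -
    have mono: "le (\<gamma> s) (\<gamma> t)" if "s \<in> {a..b}" "t \<in> {a..b}" "s \<le> t" for s t
      using \<gamma>(1) that refl unfolding directed_curve_def by (cases "s = t") auto
    show ?thesis using mono[of s b] mono[of a t] that ab xy \<gamma>(2,3) trans
      by (metis atLeastAtMost_iff order_refl less_imp_le)
  qed
  text \<open>All points of \<open>\<gamma>\<close> are causally equivalent, so running back and forth along \<open>\<gamma>\<close> is causal.\<close>
  define h where "h t = (a + b) / 2 - (b - a) / 2 * cos t" for t :: real
  have h_mem: "h t \<in> {a..b}" for t
  proof -
    have "(b - a) / 2 * cos t \<le> (b - a) / 2 * 1" "(b - a) / 2 * (- 1) \<le> (b - a) / 2 * cos t"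
      using ab cos_ge_minus_one[of t] by (intro mult_left_mono; simp)+
    then show ?thesis by (auto simp: h_def field_simps)
  qed
  have h_lip: "\<bar>h s - h t\<bar> \<le> (b - a) / 2 * \<bar>s - t\<bar>" for s t
  proof -
    \<comment> \<open>The product formula for a difference of cosines, with one sine bounded by
      \<open>1\<close> and the other by its argument, makes \<open>h\<close> globally
      Lipschitz.\<close>
    have "\<bar>cos t - cos s\<bar> \<le> \<bar>s - t\<bar>"
      using abs_sin_x_le_abs_x[of "(s - t) / 2"] abs_sin_le_one[of "(t + s) / 2"]
        mult_mono[of "\<bar>sin ((t + s) / 2)\<bar>" 1 "\<bar>sin ((s - t) / 2)\<bar>" "\<bar>(s - t) / 2\<bar>"]
      by (simp add: cos_diff_cos abs_mult)
    moreover have "\<bar>h s - h t\<bar> = (b - a) / 2 * \<bar>cos t - cos s\<bar>"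
    proof -
      have "h s - h t = (b - a) / 2 * (cos t - cos s)" by (simp add: h_def right_diff_distrib)
      then show ?thesis using ab by (simp only: abs_mult) simp
    qed
    ultimately show ?thesis using ab by (simp add: mult_left_mono)
  qed
  \<comment> \<open>The multiples of \<open>pi\<close> are the turning points. \<open>N\<close>
    traversals have length at least \<open>N * dist x y\<close>, and \<open>N\<close> is chosen to
    beat \<open>C\<close>.\<close>
  have h_pi: "\<gamma> (h (real i * pi)) = (if even i then x else y)" for i
    using \<gamma>(2,3) by (simp add: h_def cos_npi field_simps)
  obtain N :: nat where N: "C < real N * dist x y" and "N > 0"
    using reals_Archimedean3[of "dist x y"] \<open>x \<noteq> y\<close> \<open>C > 0\<close>
    by (metis less_asym' mult_zero_left neq0_conv of_nat_0 zero_less_dist_iff)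
  have dc: "directed_curve le {0..real N * pi} (\<gamma> \<circ> h)"
    unfolding directed_curve_def
  proof (intro conjI ballI impI)
    show "is_interval {0..real N * pi}" by (simp add: is_interval_cc)
    show "\<exists>s\<in>{0..real N * pi}. \<exists>t\<in>{0..real N * pi}. (\<gamma> \<circ> h) s \<noteq> (\<gamma> \<circ> h) t"
    proof (intro bexI)
      show "(\<gamma> \<circ> h) 0 \<noteq> (\<gamma> \<circ> h) pi"
        using h_pi[of 0] h_pi[of 1] \<open>x \<noteq> y\<close> by simp
    qed (use \<open>N > 0\<close> in auto)
    fix t assume "t \<in> {0..real N * pi}"
    obtain e L where e: "e > 0" and L: "L-lipschitz_on (ball (h t) e \<inter> {a..b}) \<gamma>"
      using \<gamma>(1) h_mem[of t] unfolding directed_curve_def by blast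
    have hl: "((b - a) / 2)-lipschitz_on X h" for X
      using h_lip ab by (intro lipschitz_onI) (auto simp: dist_real_def)
    define e' where "e' = e / ((b - a) / 2)"
    have "e' > 0" using e ab by (simp add: e'_def)
    have "h ` (ball t e' \<inter> {0..real N * pi}) \<subseteq> ball (h t) e \<inter> {a..b}"
    proof (clarify)
      fix s assume "s \<in> ball t e'"
      then have "(b - a) / 2 * \<bar>t - s\<bar> < e" using ab by (simp add: e'_def dist_real_def field_simps)
      then show "h s \<in> ball (h t) e \<inter> {a..b}"
        using h_lip[of t s] h_mem[of s] by (simp add: dist_real_def)
    qed
    then have "(L * ((b - a) / 2))-lipschitz_on (ball t e' \<inter> {0..real N * pi}) (\<gamma> \<circ> h)"
      using lipschitz_on_compose[OF hl lipschitz_on_subset[OF L]] by blast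
    then show "\<exists>e>0. \<exists>C. C-lipschitz_on (ball t e \<inter> {0..real N * pi}) (\<gamma> \<circ> h)"
      using \<open>e' > 0\<close> by blast
  qed (use le_\<gamma> h_mem in auto)
  have "d_length 0 (real N * pi) (\<gamma> \<circ> h) \<le> ennreal C"
    using dc h_mem by (intro C) (auto simp: causal_curve_def)
  then have "(\<Sum>i<N. dist ((\<gamma> \<circ> h) (real i * pi)) ((\<gamma> \<circ> h) (real (Suc i) * pi))) \<le> C"
    using \<open>C > 0\<close> by (intro sum_dist_chain_le[of 0 "\<lambda>i. real i * pi" N]) (auto simp del: comp_apply)
  moreover have "dist ((\<gamma> \<circ> h) (real i * pi)) ((\<gamma> \<circ> h) (real (Suc i) * pi)) = dist x y" for i
    unfolding comp_def h_pi by (simp add: dist_commute)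
  ultimately show False using N by simp
qed

subsection \<open>Time-symmetric consequences of global hyperbolicity\<close>

text \<open>The assumptions are arranged so that reversing time only permutes them; every
  consequence then holds in both time directions. \<open>near_end\<close> and
  \<open>near_start\<close> record what timelike connecting curves contribute.\<close>

locale hyperbolic_chronology =
  fixes ll le :: "'a::metric_space \<Rightarrow> 'a \<Rightarrow> bool" and tau :: "'a \<Rightarrow> 'a \<Rightarrow> ennreal"
  assumes le_refl: "le x x"
    and le_trans: "le x y \<Longrightarrow> le y z \<Longrightarrow> le x z"
    and le_antisym: "le x y \<Longrightarrow> le y x \<Longrightarrow> x = y"
    and ll_imp_le: "ll x y \<Longrightarrow> le x y"
    and tau_triangle: "le x y \<Longrightarrow> le y z \<Longrightarrow> tau x y + tau y z \<le> tau x z"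
    and tau_pos: "0 < tau x y \<longleftrightarrow> ll x y"
    and open_past: "open {x. ll x y}" and open_future: "open {y. ll x y}"
    and future_nonempty: "\<exists>z. ll x z" and past_nonempty: "\<exists>z. ll z x"
    and near_end: "ll x y \<Longrightarrow> 0 < e \<Longrightarrow> \<exists>z. ll x z \<and> ll z y \<and> dist z y < e"
    and near_start: "ll x y \<Longrightarrow> 0 < e \<Longrightarrow> \<exists>z. ll x z \<and> ll z y \<and> dist z x < e"
    and compact_diamond: "compact (causal_diamond le x y)"
    and imprisoning: "non_totally_imprisoning le"
begin

text \<open>The paired assumptions swap. Imprisonment is unchanged because
  \<open>causal_curve\<close> covers both directions.\<close>

lemma time_reversal: "hyperbolic_chronology ll\<inverse>\<inverse> le\<inverse>\<inverse> (\<lambda>x y. tau y x)"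
proof
  show "\<And>x y z. le\<inverse>\<inverse> x y \<Longrightarrow> le\<inverse>\<inverse> y z \<Longrightarrow> le\<inverse>\<inverse> x z"
    unfolding conversep_iff by (rule le_trans)
  show "\<And>x y. le\<inverse>\<inverse> x y \<Longrightarrow> le\<inverse>\<inverse> y x \<Longrightarrow> x = y"
    unfolding conversep_iff by (rule le_antisym)
  show "\<And>x y e. ll\<inverse>\<inverse> x y \<Longrightarrow> 0 < e \<Longrightarrow> \<exists>z. ll\<inverse>\<inverse> x z \<and> ll\<inverse>\<inverse> z y \<and> dist z y < e"
    unfolding conversep_iff using near_start by blast
  show "\<And>x y e. ll\<inverse>\<inverse> x y \<Longrightarrow> 0 < e \<Longrightarrow> \<exists>z. ll\<inverse>\<inverse> x z \<and> ll\<inverse>\<inverse> z y \<and> dist z x < e"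
    unfolding conversep_iff using near_end by blast
  show "\<And>x y. compact (causal_diamond le\<inverse>\<inverse> x y)"
    using compact_diamond by (simp add: causal_diamond_def Int_commute)
  show "non_totally_imprisoning le\<inverse>\<inverse>"
    using imprisoning by (simp add: non_totally_imprisoning_def causal_curve_def disj_commute)
  show "\<And>x y z. le\<inverse>\<inverse> x y \<Longrightarrow> le\<inverse>\<inverse> y z \<Longrightarrow> tau y x + tau z y \<le> tau z x"
    unfolding conversep_iff by (subst add.commute) (rule tau_triangle)
qed (simp_all add: le_refl ll_imp_le tau_pos open_past open_future future_nonempty past_nonempty)

section \<open>Push-up and limits of causal chains\<close>

text \<open>The push-up property: by the reverse triangle inequality \<open>tau x z\<close> is at
  least the positive \<open>tau x y\<close>.\<close>

lemma ll_le_trans: "ll x y \<Longrightarrow> le y z \<Longrightarrow> ll x z"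
  using tau_triangle[of x y z] tau_pos ll_imp_le by (metis add_pos_nonneg less_le_trans zero_le)

text \<open>Some \<open>z\<close> lies in the future of \<open>l\<close>, and its past is open, so
  the subsequence eventually stays in the diamond from \<open>x k\<close> to \<open>z\<close>. That
  diamond is compact, hence closed, and contains \<open>l\<close>.\<close>

lemma le_limit:
  assumes chain: "\<And>m n. m \<le> n \<Longrightarrow> le (x m) (x n)" and r: "strict_mono (r :: nat \<Rightarrow> nat)"
    and lim: "(x \<circ> r) \<longlonglongrightarrow> l"
  shows "le (x k) l"
proof -
  obtain z where "ll l z" using future_nonempty by blast
  then have "\<forall>\<^sub>F n in sequentially. ll (x (r n)) z"
    using topological_tendstoD[OF lim open_past, of z] by simp
  then have "\<forall>\<^sub>F n in sequentially. (x \<circ> r) n \<in> causal_diamond le (x k) z"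
    using eventually_ge_at_top[of k]
  proof eventually_elim
    case (elim n)
    then have "k \<le> r n" using seq_suble[OF r, of n] by simp
    then show ?case using elim chain ll_imp_le by (simp add: causal_diamond_def)
  qed
  then have "l \<in> causal_diamond le (x k) z"
    using Lim_in_closed_set[OF compact_imp_closed[OF compact_diamond] _ _ lim] by simp
  then show ?thesis by (simp add: causal_diamond_def)
qed

text \<open>Otherwise a subsequence keeps a distance \<open>e\<close> from \<open>l\<close>.
  Compactness of the diamond from \<open>x 0\<close> to \<open>l\<close> gives it an accumulation
  point \<open>l'\<close>, and antisymmetry forces \<open>l = l'\<close>.\<close>

lemma chain_convergent:
  assumes chain: "\<And>m n. m \<le> n \<Longrightarrow> le (x m) (x n)" and acc: "has_accumulation_point x"
  shows "convergent x"
proof -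
  obtain l r where r: "strict_mono r" and l: "(x \<circ> r) \<longlonglongrightarrow> l"
    using acc unfolding has_accumulation_point_def by blast
  have le_l: "le (x n) l" for n using le_limit[OF chain r l] by simp
  let ?K = "causal_diamond le (x 0) l"
  have K: "x n \<in> ?K" for n using le_l chain[of 0 n] by (simp add: causal_diamond_def)
  have "x \<longlonglongrightarrow> l"
  proof (rule ccontr)
    assume "\<not> x \<longlonglongrightarrow> l"
    then obtain e where "e > 0" and "\<exists>\<^sub>F n in sequentially. dist (x n) l \<ge> e"
      by (auto simp: tendsto_iff not_eventually not_less)
    then have "infinite {n. dist (x n) l \<ge> e}"
      by (simp add: cofinite_eq_sequentially[symmetric] frequently_cofinite)
    then obtain s :: "nat \<Rightarrow> nat" where s: "strict_mono s" and far: "\<And>n. dist (x (s n)) l \<ge> e"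
      using infinite_enumerate[of "{n. dist (x n) l \<ge> e}"] by auto
    obtain l' r' where "l' \<in> ?K" and r': "strict_mono r'" and l': "((x \<circ> s) \<circ> r') \<longlonglongrightarrow> l'"
      using seq_compactE[OF compact_diamond[of "x 0" l, unfolded compact_eq_seq_compact_metric], of "x \<circ> s"] K
      by auto
    have le_l': "le (x n) l'" for n
      by (rule le_limit[OF chain strict_mono_o[OF s r']]) (use l' in \<open>simp_all add: comp_assoc\<close>)
    \<comment> \<open>The diamond up to \<open>l'\<close> contains the whole chain and so its limit
      \<open>l\<close>; this gives \<open>le l l'\<close>, while \<open>l' \<in> ?K\<close> gives
      the converse.\<close>
    have "x n \<in> causal_diamond le (x 0) l'" for n
      using le_l' chain[of 0 n] by (simp add: causal_diamond_def)
    then have "l \<in> causal_diamond le (x 0) l'"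
      using Lim_in_closed_set[OF compact_imp_closed[OF compact_diamond] _ _ l] by simp
    then have "l = l'"
      using \<open>l' \<in> ?K\<close> by (intro le_antisym) (simp_all add: causal_diamond_def)
    then have "(\<lambda>n. dist (x (s (r' n))) l) \<longlonglongrightarrow> 0"
      using tendsto_dist[OF l' tendsto_const[of l]] by (simp add: comp_def)
    then have "e \<le> 0" by (rule tendsto_lowerbound) (simp_all add: far)
    with \<open>e > 0\<close> show False by simp
  qed
  then show ?thesis by (rule convergentI)
qed

text \<open>\<open>x 1\<close> and \<open>x 2\<close> serve as \<open>p\<close> and \<open>q\<close>
  of finite compactness, since \<open>B 1\<close> bounds \<open>tau\<close> from \<open>x 1\<close>
  to all later terms.\<close>

lemma finitely_compact_imp_convergent:
  assumes fc: "\<And>(B::real) p q x. B > 0 \<Longrightarrow> ll p q \<Longrightarrow> (\<And>n. le q (x n) \<and> tau p (x n) \<le> ennreal B) \<Longrightarrow>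
      has_accumulation_point x"
    and x: "\<And>n. n \<ge> 1 \<Longrightarrow> ll (x n) (x (n + 1))"
    and B: "\<And>n m. n \<ge> 1 \<Longrightarrow> m \<ge> 1 \<Longrightarrow> tau (x n) (x (n + m)) \<le> ennreal (B n)"
  shows "convergent x"
proof -
  \<comment> \<open>The hypotheses constrain only indices from \<open>1\<close> on; the shift by
    \<open>2\<close> makes \<open>y\<close> start at \<open>q\<close>.\<close>
  define y where "y n = x (n + 2)" for n
  have chain: "le (y m) (y n)" if "m \<le> n" for m n
    using that by (induction n rule: dec_induct)
      (use x ll_imp_le le_refl le_trans in \<open>fastforce simp: y_def\<close>)+
  have "has_accumulation_point y"
  proof (rule fc)
    show "ll (x 1) (x 2)" using x[of 1] by (simp add: numeral_2_eq_2)
    \<comment> \<open>The maximum with \<open>1\<close> supplies a positive bound when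
      \<open>B 1\<close> is not positive.\<close>
    show "0 < max (B 1) 1" by simp
    show "le (x 2) (y n) \<and> tau (x 1) (y n) \<le> ennreal (max (B 1) 1)" for n
      using chain[of 0 n] B[of 1 "n + 1"] order_trans[OF _ ennreal_leI[of "B 1" "max (B 1) 1"]]
      by (simp add: y_def numeral_2_eq_2)
  qed
  from chain_convergent[OF chain this] show ?thesis
    unfolding y_def using convergent_ignore_initial_segment[of x 2] by simp
qed

section \<open>Extending curves of bounded time separation\<close>

text \<open>Yields Condition A by contraposition. The limit of the shadowing timelike sequence is
  the missing end point, and the length bound in the diamond below it makes the arc length interval
  finite.\<close>

lemma bounded_causal_curve_extendible:
  assumes c: "0 < c" and \<gamma>: "directed_curve le (half_open 0 c) \<gamma>" and x: "ll x (\<gamma> 0)"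
    and bdd: "\<And>t. t \<in> half_open 0 c \<Longrightarrow> tau x (\<gamma> t) \<le> ennreal M"
    and complete: "\<And>(x :: nat \<Rightarrow> 'a) (B :: nat \<Rightarrow> real).
        (\<forall>n\<ge>1. 0 \<le> B n) \<Longrightarrow> B \<longlonglongrightarrow> 0 \<Longrightarrow> (\<forall>n\<ge>1. ll (x n) (x (n + 1))) \<Longrightarrow>
        (\<forall>n\<ge>1. \<forall>m\<ge>1. tau (x n) (x (n + m)) \<le> ennreal (B n)) \<Longrightarrow> convergent x"
  shows "extendible le 0 c \<gamma>"
proof -
  let ?I = "half_open 0 c"
  have mono: "le (\<gamma> s) (\<gamma> t)" if "s \<in> ?I" "t \<in> ?I" "s \<le> t" for s t
    using \<gamma> that le_refl unfolding directed_curve_def by (cases "s = t") auto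
  have zero: "0 \<in> ?I" using c by (simp add: half_open_def zero_ereal_def)
  \<comment> \<open>Approximating in \<open>ereal\<close> treats finite and infinite
    \<open>c\<close> alike.\<close>
  obtain t :: "nat \<Rightarrow> real" where t: "incseq t" "\<And>n. 0 < t n" "\<And>n. ereal (t n) < c"
    and t_lim: "(\<lambda>n. ereal (t n)) \<longlonglongrightarrow> c"
    using ereal_incseq_approx[OF c] by (metis (no_types) ereal_less(2))
  have t_mem: "t n \<in> ?I" for n using t(2,3)[of n] by (simp add: half_open_def)
  \<comment> \<open>No closeness is asked at index \<open>0\<close>, which lets the sequence begin
    at \<open>x\<close> itself.\<close>
  define P where "P n z \<longleftrightarrow> ll z (\<gamma> (t n)) \<and> (n > 0 \<longrightarrow> dist z (\<gamma> (t n)) < 1 / real n)" for n z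
  have "\<exists>f. f 0 = x \<and> (\<forall>n. P n (f n) \<and> ll (f n) (f (Suc n)))"
  proof -
    have "\<exists>f. \<forall>n. (P n (f n) \<and> (n = 0 \<longrightarrow> f n = x)) \<and> ll (f n) (f (Suc n))"
    proof (rule dependent_nat_choice)
      show "\<exists>z. P 0 z \<and> (0 = 0 \<longrightarrow> z = x)"
        using ll_le_trans[OF x mono[OF zero t_mem]] t(2)[of 0] by (auto simp: P_def less_imp_le)
      \<comment> \<open>Push-up gives \<open>ll z (\<gamma> (t (Suc n)))\<close>, and
        \<open>near_end\<close> picks the next point in between, close to the upper end.\<close>
      fix z n assume "P n z \<and> (n = 0 \<longrightarrow> z = x)"
      then have "ll z (\<gamma> (t (Suc n)))"
        using ll_le_trans mono[OF t_mem[of n] t_mem[of "Suc n"]] incseq_SucD[OF t(1)] unfolding P_def by blast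
      from near_end[OF this, of "1 / real (Suc n)"]
      show "\<exists>z'. (P (Suc n) z' \<and> (Suc n = 0 \<longrightarrow> z' = x)) \<and> ll z z'" by (auto simp: P_def)
    qed
    then show ?thesis by blast
  qed
  then obtain f where f: "f 0 = x" "\<And>n. ll (f n) (\<gamma> (t n))" "\<And>n. ll (f n) (f (Suc n))"
    and f_dist: "\<And>n. n > 0 \<Longrightarrow> dist (f n) (\<gamma> (t n)) < 1 / real n"
    unfolding P_def by blast
  have f_le: "le (f m) (f n)" if "m \<le> n" for m n
    using that by (induction n rule: dec_induct) (use f(3) ll_imp_le le_refl le_trans in blast)+
  have tau_f: "tau x (f n) \<le> ennreal M" for n
  proof -
    have "tau x (f n) \<le> tau x (f n) + tau (f n) (\<gamma> (t n))" by simp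
    also have "\<dots> \<le> tau x (\<gamma> (t n))"
      using tau_triangle f_le[of 0 n] f(1) ll_imp_le[OF f(2)] by auto
    finally show ?thesis using bdd[OF t_mem[of n]] by (rule order_trans)
  qed
  \<comment> \<open>The bound \<open>M\<close> makes these values finite, so they can be subtracted
    as reals.\<close>
  define T where "T n = enn2real (tau x (f n))" for n
  have T: "ennreal (T n) = tau x (f n)" for n
    unfolding T_def using tau_f[of n] by (intro ennreal_enn2real) (auto simp: less_top[symmetric] top_unique)
  have T_add: "ennreal (T m) + tau (f m) (f n) \<le> ennreal (T n)" if "m \<le> n" for m n
    using tau_triangle[of x "f m" "f n"] f_le[of 0 m] f_le[OF that] f(1) by (simp add: T)
  have T_nonneg: "0 \<le> T n" for n by (simp add: T_def)
  have T_mono: "incseq T"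
  proof (rule incseq_SucI)
    fix n
    have "ennreal (T n) \<le> ennreal (T n) + tau (f n) (f (Suc n))" by simp
    also have "\<dots> \<le> ennreal (T (Suc n))" by (rule T_add) simp
    finally show "T n \<le> T (Suc n)" using T_nonneg by (simp add: ennreal_le_iff)
  qed
  have T_bdd: "T n \<le> max M 0" for n
    using order_trans[OF tau_f[of n] ennreal_leI[of M "max M 0"]] by (simp add: T[symmetric] ennreal_le_iff)
  obtain S where S: "T \<longlonglongrightarrow> S" and T_le: "\<And>n. T n \<le> S"
    using incseq_convergent[OF T_mono, of "max M 0"] T_bdd by blast
  \<comment> \<open>The Cauchy bounds are \<open>S - T n\<close>: from
    \<open>T n + tau (f n) (f (n + m)) \<le> T (n + m) \<le> S\<close> the finite term
    \<open>T n\<close> cancels.\<close>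
  have "convergent f"
  proof (rule complete)
    show "\<forall>n\<ge>1. 0 \<le> S - T n" using T_le by simp
    show "(\<lambda>n. S - T n) \<longlonglongrightarrow> 0" using tendsto_diff[OF tendsto_const S, of S] by simp
    show "\<forall>n\<ge>1. ll (f n) (f (n + 1))" using f(3) by simp
    have "tau (f n) (f (n + m)) \<le> ennreal (S - T n)" for n m
    proof -
      have "ennreal (T n) + tau (f n) (f (n + m)) \<le> ennreal S"
        using order_trans[OF T_add[of n "n + m"] ennreal_leI[OF T_le]] by simp
      also have "ennreal S = ennreal (T n) + ennreal (S - T n)"
        using T_nonneg[of n] T_le[of n] by (simp add: ennreal_plus[symmetric] del: ennreal_plus)
      finally show ?thesis by simp
    qed
    then show "\<forall>n\<ge>1. \<forall>m\<ge>1. tau (f n) (f (n + m)) \<le> ennreal (S - T n)" by blast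
  qed
  then obtain l where "f \<longlonglongrightarrow> l" by (auto simp: convergent_def)
  moreover have "(\<lambda>n. dist (f n) (\<gamma> (t n))) \<longlonglongrightarrow> 0"
  proof (rule tendsto_sandwich[OF _ _ tendsto_const lim_1_over_n])
    show "\<forall>\<^sub>F n in sequentially. dist (f n) (\<gamma> (t n)) \<le> 1 / of_nat n"
      using eventually_gt_at_top[of 0] by eventually_elim (use f_dist in \<open>auto simp: less_imp_le\<close>)
  qed simp
  ultimately have lim0: "(\<lambda>n. dist (f n) (\<gamma> (t n)) + dist (f n) l) \<longlonglongrightarrow> 0"
    using tendsto_add[of _ 0 _ _ 0] by (auto simp: tendsto_dist_iff[of f])
  have lim: "(\<lambda>n. \<gamma> (t n)) \<longlonglongrightarrow> l"
    unfolding tendsto_dist_iff[of "\<lambda>n. \<gamma> (t n)"]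
    by (rule tendsto_sandwich[OF _ _ tendsto_const lim0]) (auto simp: dist_triangle3)
  have ev: "\<forall>\<^sub>F n in sequentially. s \<le> t n" if "s \<in> ?I" for s
    using order_tendstoD(1)[OF t_lim, of "ereal s"] that
    by (auto simp: half_open_def elim: eventually_mono)
  have \<gamma>_l: "le (\<gamma> s) l" if s: "s \<in> ?I" for s
  proof -
    obtain k where k: "s \<le> t k" using ev[OF s] by (auto simp: eventually_sequentially)
    have "le (\<gamma> (t k)) l"
      using le_limit[of "\<lambda>n. \<gamma> (t n)" id l k] mono[OF t_mem t_mem] t(1) lim
      by (auto simp: incseq_def strict_mono_def comp_def)
    then show ?thesis using mono[OF s t_mem k] le_trans by blast
  qed
  obtain u v where uv: "u \<in> ?I" "v \<in> ?I" "\<gamma> u \<noteq> \<gamma> v" using \<gamma> unfolding directed_curve_def by blast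
  obtain C where "C > 0"
    and C: "\<And>a' b' \<sigma>. causal_curve le {a'..b'} \<sigma> \<Longrightarrow> \<sigma> ` {a'..b'} \<subseteq> causal_diamond le (\<gamma> 0) l \<Longrightarrow>
      d_length a' b' \<sigma> \<le> ennreal C"
    using imprisoning compact_diamond[of "\<gamma> 0" l] unfolding non_totally_imprisoning_def by meson
  have sum_le: "(\<Sum>i<n. dist (\<gamma> (p i)) (\<gamma> (p (Suc i)))) \<le> C"
    if p: "p 0 = 0" "\<And>i. i < n \<Longrightarrow> p i \<le> p (Suc i)" "p n \<in> ?I" for n p
  proof -
    \<comment> \<open>Reaching past \<open>u\<close> and \<open>v\<close> keeps the restricted curve
      non-constant, as \<open>directed_curve\<close> requires.\<close>
    define w where "w = max (p n) (max u v)"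
    have w: "w \<in> ?I" using p(3) uv by (auto simp: w_def max_def)
    have sub: "{0..w} \<subseteq> ?I" using w by (auto simp: half_open_def intro: le_less_trans[of _ "ereal w"])
    have "directed_curve le {0..w} \<gamma>"
      unfolding directed_curve_def
    proof (intro conjI ballI impI)
      show "\<exists>s\<in>{0..w}. \<exists>t\<in>{0..w}. \<gamma> s \<noteq> \<gamma> t"
        using uv by (intro bexI[of _ u] bexI[of _ v]) (auto simp: w_def half_open_def)
      fix s assume "s \<in> {0..w}"
      then obtain e L where "e > 0" "L-lipschitz_on (ball s e \<inter> ?I) \<gamma>"
        using \<gamma> sub unfolding directed_curve_def by blast
      moreover have "ball s e \<inter> {0..w} \<subseteq> ball s e \<inter> ?I" using sub by blast
      ultimately show "\<exists>e>0. \<exists>C. C-lipschitz_on (ball s e \<inter> {0..w}) \<gamma>"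
        using lipschitz_on_subset by blast
    next
      fix t1 t2 assume "t1 \<in> {0..w}" "t2 \<in> {0..w}" "t1 < t2"
      then show "le (\<gamma> t1) (\<gamma> t2)" by (intro mono) (use sub in auto)
    qed (simp add: is_interval_cc)
    then have len: "d_length 0 w \<gamma> \<le> ennreal C"
      using sub mono[OF zero] \<gamma>_l by (intro C) (auto simp: causal_curve_def causal_diamond_def)
    \<comment> \<open>Appending \<open>w\<close> adds only a nonnegative summand.\<close>
    let ?p = "p(Suc n := w)"
    have "(\<Sum>i<n. dist (\<gamma> (p i)) (\<gamma> (p (Suc i)))) \<le> (\<Sum>i<Suc n. dist (\<gamma> (?p i)) (\<gamma> (?p (Suc i))))"
      by simp
    also have "\<dots> \<le> C"
      using len \<open>C > 0\<close> p by (intro sum_dist_chain_le[of 0 ?p "Suc n"]) (auto simp: less_Suc_eq w_def)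
    finally show ?thesis .
  qed
  obtain b :: real and \<phi> where b: "0 < b"
    and \<phi>: "strict_mono_on {0..<b} \<phi>" "\<phi> ` {0..<b} = ?I" and lip: "1-lipschitz_on {0..<b} (\<gamma> \<circ> \<phi>)"
  proof (rule arc_length_reparametrisation[of 0 c \<gamma> C])
    show "ereal 0 < c" using c by (simp add: zero_ereal_def)
    show "\<exists>e>0. \<exists>L. L-lipschitz_on (ball t e \<inter> ?I) \<gamma>" if "t \<in> ?I" for t
      using \<gamma> that unfolding directed_curve_def by blast
    show "(\<Sum>i<n. dist (\<gamma> (p i)) (\<gamma> (p (Suc i)))) \<le> C"
      if "p 0 = 0" "\<And>i. i < n \<Longrightarrow> p i \<le> p (Suc i)" "p n \<in> ?I" for n p
      using sum_le that by blast
  qed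
  define \<gamma>' where "\<gamma>' s = (if s < b then \<gamma> (\<phi> s) else l)" for s
  have \<phi>_mem: "\<phi> s \<in> ?I" if "s \<in> {0..<b}" for s using \<phi>(2) that by blast
  \<comment> \<open>Eventually \<open>\<gamma> (t n)\<close> is reached at a parameter between
    \<open>s\<close> and \<open>b\<close>, so its distance from \<open>\<gamma> (\<phi> s)\<close>
    is at most \<open>b - s\<close>. In the limit this is the Lipschitz bound at the new end point
    \<open>l\<close>.\<close>
  have dist_l: "dist (\<gamma> (\<phi> s)) l \<le> b - s" if s: "s \<in> {0..<b}" for s
  proof (rule tendsto_upperbound[OF tendsto_dist[OF tendsto_const lim]])
    show "\<forall>\<^sub>F n in sequentially. dist (\<gamma> (\<phi> s)) (\<gamma> (t n)) \<le> b - s"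
      using ev[OF \<phi>_mem[OF s]]
    proof eventually_elim
      case (elim n)
      obtain r where r: "r \<in> {0..<b}" "t n = \<phi> r" using \<phi>(2) t_mem[of n] by blast
      then have "s \<le> r" using strict_mono_onD[OF \<phi>(1) r(1) s] elim by linarith
      then show ?case using lipschitz_onD[OF lip s r(1)] r by (simp add: dist_real_def)
    qed
  qed simp
  have "directed_curve le {0..b} \<gamma>'"
    unfolding directed_curve_def
  proof (intro conjI ballI impI)
    obtain u' v' where "u' \<in> {0..<b}" "v' \<in> {0..<b}" "u = \<phi> u'" "v = \<phi> v'"
      using uv \<phi>(2) by (metis imageE)
    then show "\<exists>s\<in>{0..b}. \<exists>t\<in>{0..b}. \<gamma>' s \<noteq> \<gamma>' t"
      using uv by (intro bexI[of _ u'] bexI[of _ v']) (auto simp: \<gamma>'_def)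
    have "1-lipschitz_on {0..b} \<gamma>'"
    proof (rule lipschitz_onI)
      fix s r assume "s \<in> {0..b}" "r \<in> {0..b}"
      then show "dist (\<gamma>' s) (\<gamma>' r) \<le> 1 * dist s r"
        using dist_l[of s] dist_l[of r] lipschitz_onD[OF lip, of s r]
        by (auto simp: \<gamma>'_def dist_real_def dist_commute not_less)
    qed simp
    then show "\<exists>e>0. \<exists>C. C-lipschitz_on (ball s e \<inter> {0..b}) \<gamma>'" for s
      using lipschitz_on_subset[of 1 "{0..b}" \<gamma>'] by (meson inf_le2 zero_less_one)
  next
    fix s r assume "s \<in> {0..b}" "r \<in> {0..b}" "s < r"
    then show "le (\<gamma>' s) (\<gamma>' r)"
      using mono[OF \<phi>_mem \<phi>_mem, of s r] strict_mono_onD[OF \<phi>(1), of s r] \<gamma>_l[OF \<phi>_mem, of s]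
      by (auto simp: \<gamma>'_def)
  qed (simp add: is_interval_cc)
  then show ?thesis
    unfolding extendible_def using b \<phi>
    by (intro exI[of _ 0] exI[of _ b] exI[of _ \<phi>] exI[of _ \<gamma>']) (auto simp: \<gamma>'_def)
qed

text \<open>\<open>tau x (\<gamma> t)\<close> is nondecreasing in \<open>t\<close>, so it either
  tends to infinity or stays below a finite \<open>M\<close>; the latter would make
  \<open>\<gamma>\<close> extendible.\<close>

lemma inextendible_tau_tendsto:
  assumes \<gamma>: "inextendible_causal_geodesic le tau' c \<gamma>" and x: "ll x (\<gamma> 0)"
    and complete: "\<And>(x :: nat \<Rightarrow> 'a) (B :: nat \<Rightarrow> real).
        (\<forall>n\<ge>1. 0 \<le> B n) \<Longrightarrow> B \<longlonglongrightarrow> 0 \<Longrightarrow> (\<forall>n\<ge>1. ll (x n) (x (n + 1))) \<Longrightarrow>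
        (\<forall>n\<ge>1. \<forall>m\<ge>1. tau (x n) (x (n + m)) \<le> ennreal (B n)) \<Longrightarrow> convergent x"
  shows "((\<lambda>t. tau x (\<gamma> (real_of_ereal t))) \<longlongrightarrow> \<infinity>) (at_left c)"
proof -
  let ?I = "half_open 0 c"
  have dc: "directed_curve le ?I \<gamma>" and ne: "\<not> extendible le 0 c \<gamma>"
    using \<gamma> unfolding inextendible_causal_geodesic_def causal_geodesic_def by auto
  \<comment> \<open>For \<open>c = 0\<close> the interval is empty, which non-constancy
    excludes.\<close>
  obtain t0 where "t0 \<in> ?I" using dc unfolding directed_curve_def by blast
  then have "0 < c" using le_less_trans[of 0 "ereal t0" c] by (simp add: half_open_def)
  have zero: "0 \<in> ?I" using \<open>0 < c\<close> by (simp add: half_open_def zero_ereal_def)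
  have mono: "le (\<gamma> s) (\<gamma> t)" if "s \<in> ?I" "t \<in> ?I" "s \<le> t" for s t
    using dc that le_refl unfolding directed_curve_def by (cases "s = t") auto
  have tau_mono: "tau x (\<gamma> s) \<le> tau x (\<gamma> t)" if "s \<in> ?I" "t \<in> ?I" "s \<le> t" for s t
  proof -
    have "le x (\<gamma> s)" using ll_le_trans[OF x mono[OF zero that(1)]] that ll_imp_le by (auto simp: half_open_def)
    from tau_triangle[OF this mono[OF that]] show ?thesis
      by (rule order_trans[rotated]) simp
  qed
  have "\<forall>\<^sub>F t in at_left c. M < tau x (\<gamma> (real_of_ereal t))" if "M < top" for M
  proof -
    have M: "ennreal (enn2real M) = M" using that by simp
    have "\<exists>s\<in>?I. M < tau x (\<gamma> s)"
    proof (rule ccontr)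
      assume "\<not> ?thesis"
      then have "extendible le 0 c \<gamma>"
        using x dc \<open>0 < c\<close> M
        by (intro bounded_causal_curve_extendible[of c \<gamma> x "enn2real M"] complete) (auto simp: not_less)
      with ne show False ..
    qed
    then obtain s where s: "s \<in> ?I" "M < tau x (\<gamma> s)" by blast
    \<comment> \<open>The filter lives on \<open>ereal\<close>, so \<open>c = \<infinity>\<close> is
      included; points strictly between \<open>s\<close> and \<open>c\<close> are real.\<close>
    have "\<forall>\<^sub>F t in at_left c. t \<in> {ereal s<..<c}"
      using s(1) by (intro eventually_at_leftI) (auto simp: half_open_def)
    then show ?thesis
    proof eventually_elim
      case (elim t)
      then obtain r where r: "t = ereal r" by (cases t) auto
      have "r \<in> ?I" using elim s(1) by (auto simp: half_open_def r)
      then show ?case using tau_mono[OF s(1), of r] s(2) elim by (auto simp: r)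
    qed
  qed
  then show ?thesis by (intro order_tendstoI) (auto simp: infinity_ennreal_def)
qed

end

section \<open>From length spaces to the time-symmetric setting\<close>

text \<open>Openness comes from lower semicontinuity, antisymmetry from non-total imprisonment,
  nonempty pasts and futures from localizability, and nearby intermediate points from timelike
  curves.\<close>

lemma lorentzian_length_space_hyperbolic_chronology:
  assumes L: "lorentzian_length_space ll le tau" and H: "globally_hyperbolic le"
  shows "hyperbolic_chronology ll le tau"
proof -
  have pre: "causal_space_on UNIV ll le" "lower_semicontinuous_on (UNIV \<times> UNIV) (\<lambda>(x, y). tau x y)"
    "\<And>x y z. le x y \<Longrightarrow> le y z \<Longrightarrow> tau x y + tau y z \<le> tau x z"
    "\<And>x y. 0 < tau x y \<longleftrightarrow> ll x y"
    and conn: "causally_path_connected ll le" and loc: "localizable ll le tau"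
    using L unfolding lorentzian_length_space_def lorentzian_pre_length_space_on_def by blast+
  have refl: "le x x" and trans: "le x y \<Longrightarrow> le y z \<Longrightarrow> le x z" and ll_le: "ll x y \<Longrightarrow> le x y" for x y z
    using pre(1) unfolding causal_space_on_def
    by (auto simp: reflp_on_def transp_on_def)
  have nti: "non_totally_imprisoning le" and cpt: "compact (causal_diamond le x y)" for x y
    using H unfolding globally_hyperbolic_def by auto
  \<comment> \<open>\<open>ll\<close> is the superlevel set of \<open>tau\<close> at level
    \<open>0\<close>.\<close>
  have op: "open {p. ll (fst p) (snd p)}"
    using pre(2,4) unfolding lower_semicontinuous_on_def
    by (auto simp: case_prod_unfold dest!: spec[of _ 0])
  have path: "\<exists>(a::real) b \<gamma>. a < b \<and> \<gamma> a = x \<and> \<gamma> b = y \<and> continuous_on {a..b} \<gamma> \<and>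
      (\<forall>s\<in>{a<..<b}. ll x (\<gamma> s) \<and> ll (\<gamma> s) y)" if "ll x y" for x y
  proof -
    obtain a b \<gamma> where \<gamma>: "directed_curve ll {a..b} \<gamma>" "\<gamma> a = x" "\<gamma> b = y"
      using conn \<open>ll x y\<close> unfolding causally_path_connected_def directed_curve_from_to_def by blast
    have "a < b"
      using \<gamma>(1) unfolding directed_curve_def by (metis atLeastAtMost_iff not_le order_antisym order_trans)
    moreover have "ll x (\<gamma> s) \<and> ll (\<gamma> s) y" if "s \<in> {a<..<b}" for s
      using \<gamma> that unfolding directed_curve_def by force
    ultimately show ?thesis using directed_curve_continuous_on[OF \<gamma>(1)] \<gamma>(2,3)
      by (intro exI[of _ a] exI[of _ b] exI[of _ \<gamma>]) simp
  qed
  show ?thesis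
  proof
    show "le x x" for x by (rule refl)
    show "le x z" if "le x y" "le y z" for x y z using trans that by blast
    show "x = y" if "le x y" "le y x" for x y
      using non_totally_imprisoning_antisym[OF _ _ conn nti that] trans refl by blast
    show "open {x. ll x y}" for y
      using open_vimage[OF op, of "\<lambda>x. (x, y)"] by (simp add: vimage_def continuous_intros)
    show "open {y. ll x y}" for x
      using open_vimage[OF op, of "\<lambda>y. (x, y)"] by (simp add: vimage_def continuous_intros)
    show "\<exists>z. ll x z" "\<exists>z. ll z x" for x
      using loc unfolding localizable_def localizing_neighbourhood_def by blast+
    fix x y :: 'a and e :: real assume xy: "ll x y" and e: "0 < e"
    obtain a b :: real and \<gamma> where ab: "a < b" "\<gamma> a = x" "\<gamma> b = y" and cont: "continuous_on {a..b} \<gamma>"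
      and between: "\<And>s. s \<in> {a<..<b} \<Longrightarrow> ll x (\<gamma> s) \<and> ll (\<gamma> s) y"
      using path[OF xy] by blast
    have near: "\<exists>d>0. \<forall>s\<in>{a..b}. dist s r < d \<longrightarrow> dist (\<gamma> s) (\<gamma> r) < e" if "r \<in> {a..b}" for r
      using cont that e unfolding continuous_on_iff by blast
    obtain d where "d > 0" and d: "\<And>s. s \<in> {a..b} \<Longrightarrow> dist s b < d \<Longrightarrow> dist (\<gamma> s) y < e"
      using near[of b] ab by auto
    \<comment> \<open>The midpoint keeps the parameter above \<open>a\<close> when \<open>d\<close>
      is large; the minimum used near \<open>a\<close> is the mirror image.\<close>
    have "max (b - d / 2) ((a + b) / 2) \<in> {a<..<b}" "dist (max (b - d / 2) ((a + b) / 2)) b < d"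
      using ab(1) \<open>d > 0\<close> by (auto simp: dist_real_def max_def field_simps)
    then show "\<exists>z. ll x z \<and> ll z y \<and> dist z y < e"
      using between d by (meson greaterThanLessThan_subseteq_atLeastAtMost_iff order_refl subsetD)
    obtain d where "d > 0" and d: "\<And>s. s \<in> {a..b} \<Longrightarrow> dist s a < d \<Longrightarrow> dist (\<gamma> s) x < e"
      using near[of a] ab by auto
    have "min (a + d / 2) ((a + b) / 2) \<in> {a<..<b}" "dist (min (a + d / 2) ((a + b) / 2)) a < d"
      using ab(1) \<open>d > 0\<close> by (auto simp: dist_real_def min_def field_simps)
    then show "\<exists>z. ll x z \<and> ll z y \<and> dist z x < e"
      using between d by (meson greaterThanLessThan_subseteq_atLeastAtMost_iff order_refl subsetD)
  qed (use ll_le pre(3,4) cpt nti in auto)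
qed

theorem theorem3p9:
  fixes ll le :: "'a::metric_space \<Rightarrow> 'a \<Rightarrow> bool"
    and tau :: "'a \<Rightarrow> 'a \<Rightarrow> ennreal"
  assumes "lorentzian_length_space ll le tau"
    and "globally_hyperbolic le"
  shows "(finitely_compact ll le tau \<longrightarrow> timelike_Cauchy_complete ll tau) \<and>
         (timelike_Cauchy_complete ll tau \<longrightarrow> condition_A ll le tau)"
proof -
  interpret fut: hyperbolic_chronology ll le tau
    by (rule lorentzian_length_space_hyperbolic_chronology[OF assms])
  \<comment> \<open>The past halves of finite compactness, timelike Cauchy completeness and
    Condition A are the future halves for the reversed data.\<close>
  interpret past: hyperbolic_chronology "ll\<inverse>\<inverse>" "le\<inverse>\<inverse>" "\<lambda>x y. tau y x"
    by (rule fut.time_reversal)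
  show ?thesis
  proof (intro conjI impI)
    assume fc: "finitely_compact ll le tau"
    show "timelike_Cauchy_complete ll tau"
      unfolding timelike_Cauchy_complete_def
    proof (intro conjI allI impI; elim conjE)
      fix x :: "nat \<Rightarrow> 'a" and B :: "nat \<Rightarrow> real"
      assume "\<forall>n\<ge>1. ll (x n) (x (n + 1))" "\<forall>n\<ge>1. \<forall>m\<ge>1. tau (x n) (x (n + m)) \<le> ennreal (B n)"
      then show "convergent x"
        using fc unfolding finitely_compact_def
        by (intro fut.finitely_compact_imp_convergent[of x B]) blast+
    next
      fix x :: "nat \<Rightarrow> 'a" and B :: "nat \<Rightarrow> real"
      assume "\<forall>n\<ge>1. ll (x (n + 1)) (x n)" "\<forall>n\<ge>1. \<forall>m\<ge>1. tau (x (n + m)) (x n) \<le> ennreal (B n)"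
      then show "convergent x"
        using fc unfolding finitely_compact_def
        by (intro past.finitely_compact_imp_convergent[of x B]) (simp; blast)+
    qed
  next
    assume tc: "timelike_Cauchy_complete ll tau"
    show "condition_A ll le tau"
      unfolding condition_A_def
    proof (intro conjI allI impI; elim conjE)
      fix c x y \<gamma>
      assume "0 \<le> c" "ll x y" "inextendible_causal_geodesic le tau c \<gamma>" "\<gamma> 0 = y"
      then show "((\<lambda>t. tau x (\<gamma> (real_of_ereal t))) \<longlongrightarrow> \<infinity>) (at_left c)"
        using tc unfolding timelike_Cauchy_complete_def
        by (intro fut.inextendible_tau_tendsto) blast+
    next
      fix c x y \<gamma>
      assume "0 \<le> c" "ll y x" "inextendible_causal_geodesic le\<inverse>\<inverse> (\<lambda>p q. tau q p) c \<gamma>" "\<gamma> 0 = y"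
      then show "((\<lambda>t. tau (\<gamma> (real_of_ereal t)) x) \<longlongrightarrow> \<infinity>) (at_left c)"
        using tc unfolding timelike_Cauchy_complete_def
        by (intro past.inextendible_tau_tendsto) (simp; blast)+
    qed
  qed
qed

end
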